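(* Let $\Omega\subset\mathbb{R}^2$ be a bounded two-phase body with isotropic linearly elastic phases having bulk and shear moduli $\kappa_\alpha>0$, $\mu_\alpha>0$ and nonzero volume fractions $f_\alpha$ ($\alpha=1,2$). Let $\mathbf{u}$ be a displacement field with stress $\boldsymbol\tau$ solving the linear elasticity equations in $\Omega$, and let $E,a,c,A_{1b},A_{2b},A_{1s},A_{2s}$ be the quantities defined in the context. The feasible region is the set of $(E_{1b},E_{1s})\in\mathbb{R}^2$ satisfying the five inequalities $$E_{1b}\ge\frac{A_{1b}}{f_1},\qquad E_{1s}\ge\frac{A_{1s}}{f_1},$$ $$\frac{a+E\mu_2-E_{1b}(\kappa_1+\mu_2)+E_{1s}(\mu_1-\mu_2)}{\kappa_2+\mu_2}\ge\frac{A_{2b}}{f_2},$$ $$\frac{(\kappa_1-\kappa_2)E_{1b}-(\mu_1+\kappa_2)E_{1s}-a+E\kappa_2}{\kappa_2+\mu_2}\ge\frac{A_{2s}}{f_2},$$ $$4\kappa_2\mu_2c\ge E(\mu_2-\kappa_2)-\frac{E_{1b}}{\kappa_1}(\mu_2+\kappa_1)(\kappa_1-\kappa_2)+\frac{E_{1s}}{\mu_1}(\mu_1+\kappa_2)(\mu_1-\mu_2)+a.$$ The compatible region is $\{(E_{1b},E_{1s})\in\mathbb{R}^2: E_{1s}\le2\mu_1f_1k_1\}$, where $k_1>0$ is the yield threshold of phase 1. If the body has not yielded (so that the linear elasticity equations hold throughout $\Omega$ and $\epsilon_2^2+\epsilon_3^2\le k_1$ at every point of phase 1), then the feasible region intersects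 the compatible region; equivalently, if the feasible region does not intersect the compatible region, then the body must have yielded.
   Context: Phase $\alpha$ occupies $\Omega_\alpha\subset\Omega$ with characteristic function $\chi_\alpha$ ($\chi_1+\chi_2=1$ in $\Omega$ up to measure zero), and $f_\alpha=|\Omega_\alpha|/|\Omega|$. $\langle\cdot\rangle$ is the average over $\Omega$. The elasticity equations are $\nabla\cdot\boldsymbol\tau=0$ and $\boldsymbol\tau=\mu[\nabla\mathbf{u}+(\nabla\mathbf{u})^T]+(\kappa-\mu)\operatorname{Tr}(\nabla\mathbf{u})\mathbf{I}$, with $\kappa=\kappa_1\chi_1+\kappa_2\chi_2$, $\mu=\mu_1\chi_1+\mu_2\chi_2$, and $\nabla\mathbf{u}$ square integrable. In the orthonormal basis $\frac{1}{\sqrt2}\begin{bmatrix}0&1\\-1&0\end{bmatrix}$, $\frac{1}{\sqrt2}\begin{bmatrix}1&0\\0&1\end{bmatrix}$, $\frac{1}{\sqrt2}\begin{bmatrix}1&0\\0&-1\end{bmatrix}$, $\frac{1}{\sqrt2}\begin{bmatrix}0&1\\1&0\end{bmatrix}$ of $2\times2$ matrices, write $\boldsymbol\tau=(0,\tau_1,\tau_2,\tau_3)$ and $\nabla\mathbf{u}=(F_0,\epsilon_1,\epsilon_2,\epsilon_3)$. Define $E=\langle\boldsymbol\tau\cdot\nabla\mathbf{u}\rangle$ (entrywise inner product of matrices), $a=\langle\det\boldsymbol\tau\rangle$, $b=\langle\det\nabla\mathbf{u}\rangle$, $c=b-\frac12\langle F_0\rangle^2$, and, for $\alpha=1,2$,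 $A_{\alpha b}=2\kappa_\alpha\langle\chi_\alpha\epsilon_1\rangle^2$, $A_{\alpha s}=2\mu_\alpha(\langle\chi_\alpha\epsilon_2\rangle^2+\langle\chi_\alpha\epsilon_3\rangle^2)$. The yield criterion is the two-dimensional Von Mises–Tresca criterion (a threshold on $\tau_2^2+\tau_3^2$), expressed in phase 1 through the strain: phase 1 has not yielded at a point only if $\epsilon_2^2+\epsilon_3^2\le k_1$ there. The response is assumed linear as long as no yielding has occurred. *)

theory Defs
  imports "HOL-Analysis.Analysis"
begin

section \<open>Test functions and distributional derivatives in the plane\<close>

definition partial :: "2 \<Rightarrow> (real^2 \<Rightarrow> real) \<Rightarrow> real^2 \<Rightarrow> real" where
  "partial j \<phi> x = frechet_derivative \<phi> (at x) (axis j 1)"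

primrec cont_diff :: "nat \<Rightarrow> (real^2 \<Rightarrow> real) \<Rightarrow> bool" where
  "cont_diff 0 \<phi> \<longleftrightarrow> continuous_on UNIV \<phi>"
| "cont_diff (Suc k) \<phi> \<longleftrightarrow>
     (\<forall>x. \<phi> differentiable (at x)) \<and> (\<forall>j. cont_diff k (partial j \<phi>))"

definition test_functions :: "(real^2) set \<Rightarrow> (real^2 \<Rightarrow> real) set" where
  "test_functions \<Omega> = {\<phi>. (\<forall>k. cont_diff k \<phi>) \<and>
     compact (closure {x. \<phi> x \<noteq> 0}) \<and> closure {x. \<phi> x \<noteq> 0} \<subseteq> \<Omega>}"

definition locally_integrable :: "(real^2) set \<Rightarrow> (real^2 \<Rightarrow> 'a::euclidean_space) \<Rightarrow> bool" where
  "locally_integrable \<Omega> f \<longleftrightarrow>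
     (\<forall>K. compact K \<longrightarrow> K \<subseteq> \<Omega> \<longrightarrow> f absolutely_integrable_on K)"

definition square_integrable :: "(real^2) set \<Rightarrow> (real^2 \<Rightarrow> 'a::euclidean_space) \<Rightarrow> bool" where
  "square_integrable \<Omega> f \<longleftrightarrow>
     f \<in> borel_measurable (lebesgue_on \<Omega>) \<and> integrable (lebesgue_on \<Omega>) (\<lambda>x. (norm (f x))\<^sup>2)"

text \<open>The entry \<open>G x $ i $ j\<close> of the gradient is the derivative of the \<open>i\<close>-th component of \<open>u\<close>
  in direction \<open>j\<close>. Derivatives are distributional because the moduli jump across interfaces.\<close>

definition is_gradient :: "(real^2) set \<Rightarrow> (real^2 \<Rightarrow> real^2) \<Rightarrow> (real^2 \<Rightarrow> real^2^2) \<Rightarrow> bool" where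
  "is_gradient \<Omega> u G \<longleftrightarrow> locally_integrable \<Omega> u \<and> locally_integrable \<Omega> G \<and>
     (\<forall>\<phi>\<in>test_functions \<Omega>. \<forall>i j.
        (LINT x|lebesgue_on \<Omega>. u x $ i * partial j \<phi> x)
          = - (LINT x|lebesgue_on \<Omega>. G x $ i $ j * \<phi> x))"

definition divergence_free :: "(real^2) set \<Rightarrow> (real^2 \<Rightarrow> real^2^2) \<Rightarrow> bool" where
  "divergence_free \<Omega> \<tau> \<longleftrightarrow> locally_integrable \<Omega> \<tau> \<and>
     (\<forall>\<phi>\<in>test_functions \<Omega>. \<forall>i.
        (LINT x|lebesgue_on \<Omega>. (\<Sum>j\<in>UNIV. \<tau> x $ i $ j * partial j \<phi> x)) = 0)"

section \<open>Orthonormal coordinates on 2 by 2 matrices\<close>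

text \<open>The inner product \<open>\<bullet>\<close> on \<^typ>\<open>real^2^2\<close> is the entrywise one.\<close>

definition coord0 :: "real^2^2 \<Rightarrow> real" where
  "coord0 M = M \<bullet> ((1 / sqrt 2) *\<^sub>R vector [vector [0, 1], vector [-1, 0]])"

definition coord1 :: "real^2^2 \<Rightarrow> real" where
  "coord1 M = M \<bullet> ((1 / sqrt 2) *\<^sub>R vector [vector [1, 0], vector [0, 1]])"

definition coord2 :: "real^2^2 \<Rightarrow> real" where
  "coord2 M = M \<bullet> ((1 / sqrt 2) *\<^sub>R vector [vector [1, 0], vector [0, -1]])"

definition coord3 :: "real^2^2 \<Rightarrow> real" where
  "coord3 M = M \<bullet> ((1 / sqrt 2) *\<^sub>R vector [vector [0, 1], vector [1, 0]])"

section \<open>Two-phase bodies\<close>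

definition average :: "(real^2) set \<Rightarrow> (real^2 \<Rightarrow> real) \<Rightarrow> real" where
  "average \<Omega> f = (LINT x|lebesgue_on \<Omega>. f x) / measure lebesgue \<Omega>"

definition two_phase_body :: "(real^2) set \<Rightarrow> (real^2) set \<Rightarrow> (real^2) set \<Rightarrow> bool" where
  "two_phase_body \<Omega> \<Omega>\<^sub>1 \<Omega>\<^sub>2 \<longleftrightarrow> open \<Omega> \<and> bounded \<Omega> \<and>
     \<Omega>\<^sub>1 \<in> sets lebesgue \<and> \<Omega>\<^sub>2 \<in> sets lebesgue \<and> \<Omega>\<^sub>1 \<subseteq> \<Omega> \<and> \<Omega>\<^sub>2 \<subseteq> \<Omega> \<and>
     (AE x in lebesgue_on \<Omega>. indicator \<Omega>\<^sub>1 x + indicator \<Omega>\<^sub>2 x = (1::real))"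

definition isotropic_law ::
  "(real^2) set \<Rightarrow> (real^2 \<Rightarrow> real) \<Rightarrow> (real^2 \<Rightarrow> real) \<Rightarrow>
   (real^2 \<Rightarrow> real^2^2) \<Rightarrow> (real^2 \<Rightarrow> real^2^2) \<Rightarrow> bool" where
  "isotropic_law \<Omega> \<kappa> \<mu> G \<tau> \<longleftrightarrow>
     (AE x in lebesgue_on \<Omega>.
        \<tau> x = \<mu> x *\<^sub>R (G x + transpose (G x)) + ((\<kappa> x - \<mu> x) * trace (G x)) *\<^sub>R mat 1)"

definition feasible_region ::
  "real \<Rightarrow> real \<Rightarrow> real \<Rightarrow> real \<Rightarrow> real \<Rightarrow> real \<Rightarrow> real \<Rightarrow> real \<Rightarrow> real \<Rightarrow>
   real \<Rightarrow> real \<Rightarrow> real \<Rightarrow> real \<Rightarrow> (real \<times> real) set" where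
  "feasible_region \<kappa>\<^sub>1 \<kappa>\<^sub>2 \<mu>\<^sub>1 \<mu>\<^sub>2 f\<^sub>1 f\<^sub>2 E a c A\<^sub>1b A\<^sub>2b A\<^sub>1s A\<^sub>2s =
     {(E\<^sub>1b, E\<^sub>1s).
        E\<^sub>1b \<ge> A\<^sub>1b / f\<^sub>1 \<and>
        E\<^sub>1s \<ge> A\<^sub>1s / f\<^sub>1 \<and>
        (a + E * \<mu>\<^sub>2 - E\<^sub>1b * (\<kappa>\<^sub>1 + \<mu>\<^sub>2) + E\<^sub>1s * (\<mu>\<^sub>1 - \<mu>\<^sub>2)) / (\<kappa>\<^sub>2 + \<mu>\<^sub>2) \<ge> A\<^sub>2b / f\<^sub>2 \<and>
        ((\<kappa>\<^sub>1 - \<kappa>\<^sub>2) * E\<^sub>1b - (\<mu>\<^sub>1 + \<kappa>\<^sub>2) * E\<^sub>1s - a + E * \<kappa>\<^sub>2) / (\<kappa>\<^sub>2 + \<mu>\<^sub>2) \<ge> A\<^sub>2s / f\<^sub>2 \<and>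
        4 * \<kappa>\<^sub>2 * \<mu>\<^sub>2 * c \<ge>
          E * (\<mu>\<^sub>2 - \<kappa>\<^sub>2) - E\<^sub>1b / \<kappa>\<^sub>1 * (\<mu>\<^sub>2 + \<kappa>\<^sub>1) * (\<kappa>\<^sub>1 - \<kappa>\<^sub>2)
            + E\<^sub>1s / \<mu>\<^sub>1 * (\<mu>\<^sub>1 + \<kappa>\<^sub>2) * (\<mu>\<^sub>1 - \<mu>\<^sub>2) + a}"

definition compatible_region :: "real \<Rightarrow> real \<Rightarrow> real \<Rightarrow> (real \<times> real) set" where
  "compatible_region \<mu>\<^sub>1 f\<^sub>1 k\<^sub>1 = {(E\<^sub>1b, E\<^sub>1s). E\<^sub>1s \<le> 2 * \<mu>\<^sub>1 * f\<^sub>1 * k\<^sub>1}"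

end

theory Submission
  imports Defs
begin

text \<open>
  Let \<open>E\<^sub>\<alpha>\<^sub>b\<close> and \<open>E\<^sub>\<alpha>\<^sub>s\<close> be the averages of \<open>2 \<kappa>\<^sub>\<alpha> \<chi>\<^sub>\<alpha> \<epsilon>\<^sub>1\<^sup>2\<close> and
  \<open>2 \<mu>\<^sub>\<alpha> \<chi>\<^sub>\<alpha> (\<epsilon>\<^sub>2\<^sup>2 + \<epsilon>\<^sub>3\<^sup>2)\<close>. If nothing has yielded, the point \<open>(E\<^sub>1\<^sub>b, E\<^sub>1\<^sub>s)\<close> lies in both regions.
  Indeed \<open>E = E\<^sub>1\<^sub>b + E\<^sub>2\<^sub>b + E\<^sub>1\<^sub>s + E\<^sub>2\<^sub>s\<close> and
  \<open>a = \<kappa>\<^sub>1 E\<^sub>1\<^sub>b + \<kappa>\<^sub>2 E\<^sub>2\<^sub>b - \<mu>\<^sub>1 E\<^sub>1\<^sub>s - \<mu>\<^sub>2 E\<^sub>2\<^sub>s\<close>; solving for \<open>E\<^sub>2\<^sub>b\<close> and \<open>E\<^sub>2\<^sub>s\<close> gives the two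
  fractions defining the feasible region, so its first four inequalities are the Cauchy-Schwarz
  inequality on each phase. The fifth is the Cauchy-Schwarz inequality for \<open>F\<^sub>0\<close>, since
  \<open>2 det \<nabla>u = F\<^sub>0\<^sup>2 + \<epsilon>\<^sub>1\<^sup>2 - \<epsilon>\<^sub>2\<^sup>2 - \<epsilon>\<^sub>3\<^sup>2\<close>. The yield criterion, averaged over phase 1,
  bounds \<open>E\<^sub>1\<^sub>s\<close>.
\<close>

lemma coord_eqs:
  "coord0 M = (M$1$2 - M$2$1) / sqrt 2"
  "coord1 M = (M$1$1 + M$2$2) / sqrt 2"
  "coord2 M = (M$1$1 - M$2$2) / sqrt 2"
  "coord3 M = (M$1$2 + M$2$1) / sqrt 2"
  by (simp_all add: coord0_def coord1_def coord2_def coord3_def inner_vec_def sum_2 field_simps)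

text \<open>The determinant is a quadratic form which this orthonormal basis diagonalises: rotation
  and trace enter with a plus sign, the two shears with a minus sign.\<close>

lemma det_eq_coords:
  "det M = ((coord0 M)\<^sup>2 + (coord1 M)\<^sup>2 - ((coord2 M)\<^sup>2 + (coord3 M)\<^sup>2)) / 2"
  by (simp add: coord_eqs det_2 power_divide) (simp add: field_simps power2_eq_square)

text \<open>The right-hand side of \<open>isotropic_law\<close> with constant moduli, so that work
  inside a single phase is matrix algebra.\<close>

definition hooke_stress :: "real \<Rightarrow> real \<Rightarrow> real^2^2 \<Rightarrow> real^2^2" where
  "hooke_stress k m G = m *\<^sub>R (G + transpose G) + ((k - m) * trace G) *\<^sub>R mat 1"

lemma hooke_stress_nth:
  "hooke_stress k m G $ 1 $ 1 = k * (G$1$1 + G$2$2) + m * (G$1$1 - G$2$2)"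
  "hooke_stress k m G $ 1 $ 2 = m * (G$1$2 + G$2$1)"
  "hooke_stress k m G $ 2 $ 1 = m * (G$1$2 + G$2$1)"
  "hooke_stress k m G $ 2 $ 2 = k * (G$1$1 + G$2$2) - m * (G$1$1 - G$2$2)"
  by (simp_all add: hooke_stress_def transpose_def trace_def mat_def sum_2 algebra_simps)

text \<open>The stress has coordinates \<open>0\<close>, \<open>2 * k * coord1 G\<close>,
  \<open>2 * m * coord2 G\<close>, \<open>2 * m * coord3 G\<close>; being symmetric, it does no work
  on the rotation.\<close>

lemma hooke_stress_inner:
  "hooke_stress k m G \<bullet> G
     = 2 * k * (coord1 G)\<^sup>2 + 2 * m * ((coord2 G)\<^sup>2 + (coord3 G)\<^sup>2)"
  by (simp add: coord_eqs inner_vec_def sum_2 hooke_stress_nth power_divide)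
    (simp add: field_simps power2_eq_square)

lemma det_hooke_stress:
  "det (hooke_stress k m G)
     = 2 * k\<^sup>2 * (coord1 G)\<^sup>2 - 2 * m\<^sup>2 * ((coord2 G)\<^sup>2 + (coord3 G)\<^sup>2)"
  by (simp add: coord_eqs det_2 hooke_stress_nth power_divide)
    (simp add: field_simps power2_eq_square)

text \<open>Integrating \<open>(f x - t)\<^sup>2\<close> over \<open>A\<close> gives a quadratic in
  \<open>t\<close> that is never negative, so its discriminant cannot be positive.\<close>

lemma (in finite_measure) indicator_Cauchy_Schwarz:
  fixes f :: "'a \<Rightarrow> real"
  assumes A: "A \<in> sets M" and f: "f \<in> borel_measurable M" "integrable M (\<lambda>x. (f x)\<^sup>2)"
  shows "(LINT x|M. indicator A x * f x)\<^sup>2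
    \<le> measure M A * (LINT x|M. indicator A x * (f x)\<^sup>2)"
proof -
  define m p q where "m = measure M A" and "p = (LINT x|M. indicator A x * f x)"
    and "q = (LINT x|M. indicator A x * (f x)\<^sup>2)"
  have fi: "integrable M f"
    using f by (rule square_integrable_imp_integrable)
  have ints: "integrable M (\<lambda>x. indicator A x * (f x)\<^sup>2)" "integrable M (\<lambda>x. indicator A x * f x)"
    "integrable M (\<lambda>x. indicator A x :: real)"
    using integrable_mult_indicator[OF A f(2)] integrable_mult_indicator[OF A fi] A
    by (auto simp: less_top[symmetric])
  have nonneg: "0 \<le> q - 2 * t * p + t\<^sup>2 * m" for t
  proof -
    have "0 \<le> (LINT x|M. indicator A x * (f x - t)\<^sup>2)"
      by (intro integral_nonneg_AE) auto
    also have "\<dots> = (LINT x|M. indicator A x * (f x)\<^sup>2 - 2 * t * (indicator A x * f x)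
        + t\<^sup>2 * indicator A x)"
      by (intro Bochner_Integration.integral_cong) (auto simp: power2_eq_square algebra_simps)
    also have "\<dots> = q - 2 * t * p + t\<^sup>2 * m"
      using ints A by (simp add: m_def p_def q_def)
    finally show ?thesis .
  qed
  have "p\<^sup>2 \<le> m * q"
  proof (cases "m = 0")
    case True
    \<comment> \<open>The quadratic is now linear in \<open>t\<close>; for nonzero \<open>p\<close>
      the chosen \<open>t\<close> would give it the value -1.\<close>
    have "p = 0"
      using nonneg[of "(q + 1) / (2 * p)"] True by (cases "p = 0") auto
    then show ?thesis
      using True by simp
  next
    case False
    then have "m > 0"
      by (simp add: m_def zero_less_measure_iff)
    \<comment> \<open>The quadratic attains its minimum at \<open>p / m\<close>.\<close>
    then show ?thesis
      using nonneg[of "p / m"] by (simp add: field_simps power2_eq_square)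
  qed
  then show ?thesis
    by (simp add: m_def p_def q_def)
qed

lemma average_Cauchy_Schwarz:
  assumes \<Omega>: "\<Omega> \<in> lmeasurable" and A: "A \<in> sets lebesgue" "A \<subseteq> \<Omega>"
    and f: "f \<in> borel_measurable (lebesgue_on \<Omega>)" "integrable (lebesgue_on \<Omega>) (\<lambda>x. (f x)\<^sup>2)"
  shows "(average \<Omega> (\<lambda>x. indicator A x * f x))\<^sup>2
    \<le> measure lebesgue A / measure lebesgue \<Omega> * average \<Omega> (\<lambda>x. indicator A x * (f x)\<^sup>2)"
proof -
  interpret finite_measure "lebesgue_on \<Omega>"
    using \<Omega> by (rule finite_measure_lebesgue_on)
  have "A \<in> sets (lebesgue_on \<Omega>)"
    using A \<Omega> by (simp add: sets_restrict_space_iff fmeasurableD)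
  from indicator_Cauchy_Schwarz[OF this f] show ?thesis
    using A \<Omega>
    by (simp add: average_def measure_restrict_space fmeasurableD power_divide power2_eq_square
        divide_right_mono)
qed

text \<open>The left-hand function need not be assumed measurable because Lebesgue measure is complete.\<close>

lemma average_eq_combination:
  fixes f g\<^sub>1 g\<^sub>2 g\<^sub>3 g\<^sub>4 :: "real^2 \<Rightarrow> real"
  assumes \<Omega>: "\<Omega> \<in> sets lebesgue"
    and g: "integrable (lebesgue_on \<Omega>) g\<^sub>1" "integrable (lebesgue_on \<Omega>) g\<^sub>2"
      "integrable (lebesgue_on \<Omega>) g\<^sub>3" "integrable (lebesgue_on \<Omega>) g\<^sub>4"
    and eq: "AE x in lebesgue_on \<Omega>.
      f x = c\<^sub>1 * g\<^sub>1 x + c\<^sub>2 * g\<^sub>2 x + c\<^sub>3 * g\<^sub>3 x + c\<^sub>4 * g\<^sub>4 x"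
  shows "average \<Omega> f = c\<^sub>1 * average \<Omega> g\<^sub>1 + c\<^sub>2 * average \<Omega> g\<^sub>2
    + c\<^sub>3 * average \<Omega> g\<^sub>3 + c\<^sub>4 * average \<Omega> g\<^sub>4"
proof -
  define h where "h x = c\<^sub>1 * g\<^sub>1 x + c\<^sub>2 * g\<^sub>2 x + c\<^sub>3 * g\<^sub>3 x + c\<^sub>4 * g\<^sub>4 x" for x
  have h: "integrable (lebesgue_on \<Omega>) h"
    unfolding h_def using g by (intro Bochner_Integration.integrable_add integrable_mult_right) auto
  \<comment> \<open>Extension by zero moves the question to \<open>lebesgue\<close>, where
    \<open>borel_measurable_AE\<close> transfers measurability along almost-everywhere
    equality.\<close>
  have "(\<lambda>x. if x \<in> \<Omega> then f x else 0) \<in> borel_measurable lebesgue"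
  proof (rule borel_measurable_AE)
    show "(\<lambda>x. if x \<in> \<Omega> then h x else 0) \<in> borel_measurable lebesgue"
      using borel_measurable_integrable[OF h] \<Omega> by (simp add: borel_measurable_if)
    show "AE x in lebesgue. (if x \<in> \<Omega> then h x else 0) = (if x \<in> \<Omega> then f x else 0)"
      using eq \<Omega> by (auto simp: AE_restrict_space_iff h_def elim: AE_mp)
  qed
  then have "f \<in> borel_measurable (lebesgue_on \<Omega>)"
    using \<Omega> by (simp add: borel_measurable_if)
  then have "(LINT x|lebesgue_on \<Omega>. f x) = (LINT x|lebesgue_on \<Omega>. h x)"
    using borel_measurable_integrable[OF h] eq
    by (intro integral_cong_AE) (simp_all add: h_def[symmetric])
  also have "\<dots> = c\<^sub>1 * (LINT x|lebesgue_on \<Omega>. g\<^sub>1 x) + c\<^sub>2 * (LINT x|lebesgue_on \<Omega>. g\<^sub>2 x)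
      + c\<^sub>3 * (LINT x|lebesgue_on \<Omega>. g\<^sub>3 x) + c\<^sub>4 * (LINT x|lebesgue_on \<Omega>. g\<^sub>4 x)"
    unfolding h_def using g by simp
  finally show ?thesis
    by (simp add: average_def add_divide_distrib)
qed

text \<open>Every coordinate is an inner product with a fixed matrix \<open>B\<close>, and
  Cauchy-Schwarz dominates its square by a constant times
  \<open>(norm (G x))\<^sup>2\<close>.\<close>

lemma square_integrable_inner:
  assumes G: "square_integrable \<Omega> G"
  shows "(\<lambda>x. G x \<bullet> B) \<in> borel_measurable (lebesgue_on \<Omega>)"
    "integrable (lebesgue_on \<Omega>) (\<lambda>x. (G x \<bullet> B)\<^sup>2)"
proof -
  have Gm: "G \<in> borel_measurable (lebesgue_on \<Omega>)"
    and Gi: "integrable (lebesgue_on \<Omega>) (\<lambda>x. (norm (G x))\<^sup>2)"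
    using G by (auto simp: square_integrable_def)
  show m: "(\<lambda>x. G x \<bullet> B) \<in> borel_measurable (lebesgue_on \<Omega>)"
    using Gm by simp
  show "integrable (lebesgue_on \<Omega>) (\<lambda>x. (G x \<bullet> B)\<^sup>2)"
  proof (rule Bochner_Integration.integrable_bound)
    show "integrable (lebesgue_on \<Omega>) (\<lambda>x. (norm B)\<^sup>2 * (norm (G x))\<^sup>2)"
      using Gi by simp
    show "(\<lambda>x. (G x \<bullet> B)\<^sup>2) \<in> borel_measurable (lebesgue_on \<Omega>)"
      using m by simp
    have "(G x \<bullet> B)\<^sup>2 \<le> (norm B)\<^sup>2 * (norm (G x))\<^sup>2" for x
      using power_mono[OF Cauchy_Schwarz_ineq2[of "G x" B], of 2]
      by (simp add: power_mult_distrib mult.commute)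
    then show "AE x in lebesgue_on \<Omega>. norm ((G x \<bullet> B)\<^sup>2) \<le> norm ((norm B)\<^sup>2 * (norm (G x))\<^sup>2)"
      by simp
  qed
qed

theorem mainTheorem9:
  fixes \<Omega> \<Omega>\<^sub>1 \<Omega>\<^sub>2 Y :: "(real^2) set"
    and u :: "real^2 \<Rightarrow> real^2" and G \<tau> :: "real^2 \<Rightarrow> real^2^2"
    and \<kappa> \<mu> :: "real^2 \<Rightarrow> real"
    and \<kappa>\<^sub>1 \<kappa>\<^sub>2 \<mu>\<^sub>1 \<mu>\<^sub>2 k\<^sub>1 f\<^sub>1 f\<^sub>2 E a b c A\<^sub>1b A\<^sub>2b A\<^sub>1s A\<^sub>2s :: real
  assumes body: "two_phase_body \<Omega> \<Omega>\<^sub>1 \<Omega>\<^sub>2"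
    and moduli_pos: "\<kappa>\<^sub>1 > 0" "\<kappa>\<^sub>2 > 0" "\<mu>\<^sub>1 > 0" "\<mu>\<^sub>2 > 0"
    and threshold_pos: "k\<^sub>1 > 0"
    and fractions: "f\<^sub>1 = measure lebesgue \<Omega>\<^sub>1 / measure lebesgue \<Omega>"
      "f\<^sub>2 = measure lebesgue \<Omega>\<^sub>2 / measure lebesgue \<Omega>"
    and fractions_nonzero: "f\<^sub>1 \<noteq> 0" "f\<^sub>2 \<noteq> 0"
    and moduli: "\<And>x. \<kappa> x = \<kappa>\<^sub>1 * indicator \<Omega>\<^sub>1 x + \<kappa>\<^sub>2 * indicator \<Omega>\<^sub>2 x"
      "\<And>x. \<mu> x = \<mu>\<^sub>1 * indicator \<Omega>\<^sub>1 x + \<mu>\<^sub>2 * indicator \<Omega>\<^sub>2 x"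
    and gradient: "is_gradient \<Omega> u G" "square_integrable \<Omega> G"
    and equilibrium: "divergence_free \<Omega> \<tau>"
    (* Y is the set of points at which the body has yielded *)
    and yield_set: "Y \<subseteq> \<Omega>"
    and linear_response: "Y = {} \<Longrightarrow> isotropic_law \<Omega> \<kappa> \<mu> G \<tau>"
    and yield_criterion:
      "AE x in lebesgue_on \<Omega>. x \<in> \<Omega>\<^sub>1 \<and> x \<notin> Y \<longrightarrow> (coord2 (G x))\<^sup>2 + (coord3 (G x))\<^sup>2 \<le> k\<^sub>1"
    and E: "E = average \<Omega> (\<lambda>x. \<tau> x \<bullet> G x)"
    and a: "a = average \<Omega> (\<lambda>x. det (\<tau> x))"
    and b: "b = average \<Omega> (\<lambda>x. det (G x))"
    and c: "c = b - 1 / 2 * (average \<Omega> (\<lambda>x. coord0 (G x)))\<^sup>2"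
    and bulk: "A\<^sub>1b = 2 * \<kappa>\<^sub>1 * (average \<Omega> (\<lambda>x. indicator \<Omega>\<^sub>1 x * coord1 (G x)))\<^sup>2"
      "A\<^sub>2b = 2 * \<kappa>\<^sub>2 * (average \<Omega> (\<lambda>x. indicator \<Omega>\<^sub>2 x * coord1 (G x)))\<^sup>2"
    and shear: "A\<^sub>1s = 2 * \<mu>\<^sub>1 * ((average \<Omega> (\<lambda>x. indicator \<Omega>\<^sub>1 x * coord2 (G x)))\<^sup>2
        + (average \<Omega> (\<lambda>x. indicator \<Omega>\<^sub>1 x * coord3 (G x)))\<^sup>2)"
      "A\<^sub>2s = 2 * \<mu>\<^sub>2 * ((average \<Omega> (\<lambda>x. indicator \<Omega>\<^sub>2 x * coord2 (G x)))\<^sup>2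
        + (average \<Omega> (\<lambda>x. indicator \<Omega>\<^sub>2 x * coord3 (G x)))\<^sup>2)"
  shows "(Y = {} \<longrightarrow>
      feasible_region \<kappa>\<^sub>1 \<kappa>\<^sub>2 \<mu>\<^sub>1 \<mu>\<^sub>2 f\<^sub>1 f\<^sub>2 E a c A\<^sub>1b A\<^sub>2b A\<^sub>1s A\<^sub>2s \<inter> compatible_region \<mu>\<^sub>1 f\<^sub>1 k\<^sub>1 \<noteq> {})
    \<and> (feasible_region \<kappa>\<^sub>1 \<kappa>\<^sub>2 \<mu>\<^sub>1 \<mu>\<^sub>2 f\<^sub>1 f\<^sub>2 E a c A\<^sub>1b A\<^sub>2b A\<^sub>1s A\<^sub>2s \<inter> compatible_region \<mu>\<^sub>1 f\<^sub>1 k\<^sub>1 = {}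
      \<longrightarrow> Y \<noteq> {})"
proof -
  have "feasible_region \<kappa>\<^sub>1 \<kappa>\<^sub>2 \<mu>\<^sub>1 \<mu>\<^sub>2 f\<^sub>1 f\<^sub>2 E a c A\<^sub>1b A\<^sub>2b A\<^sub>1s A\<^sub>2s \<inter> compatible_region \<mu>\<^sub>1 f\<^sub>1 k\<^sub>1 \<noteq> {}"
    if unyielded: "Y = {}"
  proof -
    let ?M = "lebesgue_on \<Omega>"
    let ?av = "average \<Omega>"
    let ?s = "\<lambda>x. (coord2 (G x))\<^sup>2 + (coord3 (G x))\<^sup>2"
    have \<Omega>: "\<Omega> \<in> lmeasurable"
      and \<Omega>\<^sub>1: "\<Omega>\<^sub>1 \<in> sets lebesgue" "\<Omega>\<^sub>1 \<subseteq> \<Omega>" and \<Omega>\<^sub>2: "\<Omega>\<^sub>2 \<in> sets lebesgue" "\<Omega>\<^sub>2 \<subseteq> \<Omega>"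
      and cover: "AE x in ?M. indicator \<Omega>\<^sub>1 x + indicator \<Omega>\<^sub>2 x = (1::real)"
      using body by (auto simp: two_phase_body_def lmeasurable_open)
    then have \<Omega>_sets: "\<Omega> \<in> sets lebesgue"
      and sets: "\<Omega>\<^sub>1 \<in> sets ?M" "\<Omega>\<^sub>2 \<in> sets ?M"
      by (auto simp: fmeasurableD sets_restrict_space_iff)
    \<comment> \<open>Division by zero yields 0, so nonzero fractions already exclude a null
      body.\<close>
    have V: "measure lebesgue \<Omega> > 0" and f_pos: "f\<^sub>1 > 0" "f\<^sub>2 > 0"
      using fractions fractions_nonzero by (auto simp: zero_less_measure_iff)

    have G: "(\<lambda>x. coord0 (G x)) \<in> borel_measurable ?M" "(\<lambda>x. coord1 (G x)) \<in> borel_measurable ?M"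
        "(\<lambda>x. coord2 (G x)) \<in> borel_measurable ?M" "(\<lambda>x. coord3 (G x)) \<in> borel_measurable ?M"
      and sq: "integrable ?M (\<lambda>x. (coord0 (G x))\<^sup>2)" "integrable ?M (\<lambda>x. (coord1 (G x))\<^sup>2)"
        "integrable ?M (\<lambda>x. (coord2 (G x))\<^sup>2)" "integrable ?M (\<lambda>x. (coord3 (G x))\<^sup>2)"
      unfolding coord0_def coord1_def coord2_def coord3_def
      by (intro square_integrable_inner gradient(2))+
    have ind: "integrable ?M (\<lambda>x. indicator A x * h x)"
      if "A \<in> sets ?M" "integrable ?M h" for A and h :: "real^2 \<Rightarrow> real"
      using integrable_mult_indicator[OF that] by simp
    have s: "integrable ?M ?s"
      using sq by simp

    \<comment> \<open>The phase energies stripped of their moduli: the bulk energy of phase \<alpha>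
      is 2 \<kappa> P and its shear energy is 2 \<mu> S, with the constants of that phase.\<close>
    define P\<^sub>1 where "P\<^sub>1 = ?av (\<lambda>x. indicator \<Omega>\<^sub>1 x * (coord1 (G x))\<^sup>2)"
    define P\<^sub>2 where "P\<^sub>2 = ?av (\<lambda>x. indicator \<Omega>\<^sub>2 x * (coord1 (G x))\<^sup>2)"
    define S\<^sub>1 where "S\<^sub>1 = ?av (\<lambda>x. indicator \<Omega>\<^sub>1 x * ?s x)"
    define S\<^sub>2 where "S\<^sub>2 = ?av (\<lambda>x. indicator \<Omega>\<^sub>2 x * ?s x)"
    define F where "F = ?av (\<lambda>x. (coord0 (G x))\<^sup>2)"

    note combination = average_eq_combination[OF \<Omega>_sets
        ind[OF sets(1) sq(2)] ind[OF sets(2) sq(2)] ind[OF sets(1) s] ind[OF sets(2) s],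
        folded P\<^sub>1_def P\<^sub>2_def S\<^sub>1_def S\<^sub>2_def]

    \<comment> \<open>Two indicators summing to 1 put almost every point in exactly one phase, where
      the law reduces to that phase's constant moduli.\<close>
    have phases: "AE x in ?M.
        x \<in> \<Omega>\<^sub>1 \<and> x \<notin> \<Omega>\<^sub>2 \<and> \<tau> x = hooke_stress \<kappa>\<^sub>1 \<mu>\<^sub>1 (G x) \<or>
        x \<notin> \<Omega>\<^sub>1 \<and> x \<in> \<Omega>\<^sub>2 \<and> \<tau> x = hooke_stress \<kappa>\<^sub>2 \<mu>\<^sub>2 (G x)"
      using cover linear_response[OF unyielded, unfolded isotropic_law_def]
      by eventually_elim (auto simp: moduli hooke_stress_def indicator_def split: if_splits)

    have E_eq: "E = 2 * \<kappa>\<^sub>1 * P\<^sub>1 + 2 * \<kappa>\<^sub>2 * P\<^sub>2 + 2 * \<mu>\<^sub>1 * S\<^sub>1 + 2 * \<mu>\<^sub>2 * S\<^sub>2"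
      unfolding E
    proof (rule combination)
      show "AE x in ?M. \<tau> x \<bullet> G x
          = 2 * \<kappa>\<^sub>1 * (indicator \<Omega>\<^sub>1 x * (coord1 (G x))\<^sup>2) + 2 * \<kappa>\<^sub>2 * (indicator \<Omega>\<^sub>2 x * (coord1 (G x))\<^sup>2)
          + 2 * \<mu>\<^sub>1 * (indicator \<Omega>\<^sub>1 x * ?s x) + 2 * \<mu>\<^sub>2 * (indicator \<Omega>\<^sub>2 x * ?s x)"
        using phases by eventually_elim (auto simp: hooke_stress_inner)
    qed
    \<comment> \<open>Negative coefficients are added, here and in \<open>split\<close>, to fit the
      four-term sum in \<open>combination\<close>.\<close>
    have a_eq: "a = 2 * \<kappa>\<^sub>1\<^sup>2 * P\<^sub>1 + 2 * \<kappa>\<^sub>2\<^sup>2 * P\<^sub>2 + - 2 * \<mu>\<^sub>1\<^sup>2 * S\<^sub>1 + - 2 * \<mu>\<^sub>2\<^sup>2 * S\<^sub>2"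
      unfolding a
    proof (rule combination)
      show "AE x in ?M. det (\<tau> x)
          = 2 * \<kappa>\<^sub>1\<^sup>2 * (indicator \<Omega>\<^sub>1 x * (coord1 (G x))\<^sup>2) + 2 * \<kappa>\<^sub>2\<^sup>2 * (indicator \<Omega>\<^sub>2 x * (coord1 (G x))\<^sup>2)
          + - 2 * \<mu>\<^sub>1\<^sup>2 * (indicator \<Omega>\<^sub>1 x * ?s x) + - 2 * \<mu>\<^sub>2\<^sup>2 * (indicator \<Omega>\<^sub>2 x * ?s x)"
        using phases by eventually_elim (auto simp: det_hooke_stress)
    qed
    have split: "?av (\<lambda>x. (coord1 (G x))\<^sup>2 - ?s x) = 1 * P\<^sub>1 + 1 * P\<^sub>2 + - 1 * S\<^sub>1 + - 1 * S\<^sub>2"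
    proof (rule combination)
      show "AE x in ?M. (coord1 (G x))\<^sup>2 - ?s x
          = 1 * (indicator \<Omega>\<^sub>1 x * (coord1 (G x))\<^sup>2) + 1 * (indicator \<Omega>\<^sub>2 x * (coord1 (G x))\<^sup>2)
          + - 1 * (indicator \<Omega>\<^sub>1 x * ?s x) + - 1 * (indicator \<Omega>\<^sub>2 x * ?s x)"
        using phases by eventually_elim auto
    qed
    have "b = (F + ?av (\<lambda>x. (coord1 (G x))\<^sup>2 - ?s x)) / 2"
      unfolding b F_def average_def det_eq_coords using sq
      by (simp add: add_divide_distrib diff_divide_distrib)
    then have b_eq: "2 * b = F + P\<^sub>1 + P\<^sub>2 - S\<^sub>1 - S\<^sub>2"
      using split by simp

    have shear_sum: "?av (\<lambda>x. indicator A x * ?s x)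
        = ?av (\<lambda>x. indicator A x * (coord2 (G x))\<^sup>2) + ?av (\<lambda>x. indicator A x * (coord3 (G x))\<^sup>2)"
      if "A \<in> sets ?M" for A
      using ind[OF that sq(3)] ind[OF that sq(4)]
      by (simp add: average_def distrib_left add_divide_distrib)
    note CS = average_Cauchy_Schwarz[OF \<Omega>]
    have bulk_bounds: "A\<^sub>1b / f\<^sub>1 \<le> 2 * \<kappa>\<^sub>1 * P\<^sub>1" "A\<^sub>2b / f\<^sub>2 \<le> 2 * \<kappa>\<^sub>2 * P\<^sub>2"
      using CS[OF \<Omega>\<^sub>1 G(2) sq(2)] CS[OF \<Omega>\<^sub>2 G(2) sq(2)] f_pos moduli_pos
      by (simp_all add: bulk P\<^sub>1_def P\<^sub>2_def fractions[symmetric] pos_divide_le_eq mult_ac)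
    have "(?av (\<lambda>x. indicator \<Omega>\<^sub>1 x * coord2 (G x)))\<^sup>2 + (?av (\<lambda>x. indicator \<Omega>\<^sub>1 x * coord3 (G x)))\<^sup>2
        \<le> f\<^sub>1 * S\<^sub>1"
      using CS[OF \<Omega>\<^sub>1 G(3) sq(3)] CS[OF \<Omega>\<^sub>1 G(4) sq(4)]
      unfolding S\<^sub>1_def shear_sum[OF sets(1)] fractions[symmetric]
      by (simp add: distrib_left)
    moreover
    have "(?av (\<lambda>x. indicator \<Omega>\<^sub>2 x * coord2 (G x)))\<^sup>2 + (?av (\<lambda>x. indicator \<Omega>\<^sub>2 x * coord3 (G x)))\<^sup>2
        \<le> f\<^sub>2 * S\<^sub>2"
      using CS[OF \<Omega>\<^sub>2 G(3) sq(3)] CS[OF \<Omega>\<^sub>2 G(4) sq(4)]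
      unfolding S\<^sub>2_def shear_sum[OF sets(2)] fractions[symmetric]
      by (simp add: distrib_left)
    ultimately have shear_bounds: "A\<^sub>1s / f\<^sub>1 \<le> 2 * \<mu>\<^sub>1 * S\<^sub>1" "A\<^sub>2s / f\<^sub>2 \<le> 2 * \<mu>\<^sub>2 * S\<^sub>2"
      using f_pos moduli_pos by (simp_all add: shear pos_divide_le_eq mult_ac)

    have on_\<Omega>: "?av (\<lambda>x. indicator \<Omega> x * h x) = ?av h" for h
      unfolding average_def
      by (intro arg_cong2[where f = "(/)"] Bochner_Integration.integral_cong) auto
    \<comment> \<open>Cauchy-Schwarz with the whole body as the set, whose volume ratio is
      1.\<close>
    have "(?av (\<lambda>x. coord0 (G x)))\<^sup>2 \<le> F"
      using CS[OF \<Omega>_sets order.refl G(1) sq(1)] V by (simp add: on_\<Omega> F_def)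
    \<comment> \<open>Subtracting the squared mean rotation from \<open>2 * b\<close> leaves
      \<open>2 * c\<close>, so the rotation contributes only the nonnegative variance
      \<open>F - (?av (\<lambda>x. coord0 (G x)))\<^sup>2\<close>.\<close>
    then have c_bound: "P\<^sub>1 + P\<^sub>2 - S\<^sub>1 - S\<^sub>2 \<le> 2 * c"
      using b_eq by (simp add: c)

    have "(LINT x|?M. indicator \<Omega>\<^sub>1 x * ?s x) \<le> (LINT x|?M. indicator \<Omega>\<^sub>1 x * k\<^sub>1)"
    proof (rule integral_mono_AE)
      interpret finite_measure ?M
        using \<Omega> by (rule finite_measure_lebesgue_on)
      show "integrable ?M (\<lambda>x. indicator \<Omega>\<^sub>1 x * k\<^sub>1)"
        by (rule ind[OF sets(1)]) simp
      show "AE x in ?M. indicator \<Omega>\<^sub>1 x * ?s x \<le> indicator \<Omega>\<^sub>1 x * k\<^sub>1"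
        using yield_criterion by eventually_elim (auto simp: unyielded indicator_def)
    qed (rule ind[OF sets(1) s])
    also have "\<dots> = measure lebesgue \<Omega>\<^sub>1 * k\<^sub>1"
      using sets(1) \<Omega>_sets \<Omega>\<^sub>1 by (simp add: measure_restrict_space Int_absorb2)
    finally have "S\<^sub>1 \<le> f\<^sub>1 * k\<^sub>1"
      using V by (simp add: S\<^sub>1_def average_def fractions divide_right_mono)
    then have compatible: "(2 * \<kappa>\<^sub>1 * P\<^sub>1, 2 * \<mu>\<^sub>1 * S\<^sub>1) \<in> compatible_region \<mu>\<^sub>1 f\<^sub>1 k\<^sub>1"
      using moduli_pos by (simp add: compatible_region_def)

    \<comment> \<open>In \<open>a + E * \<mu>\<^sub>2\<close> the shear energy of phase 2 cancels;
      removing the phase 1 terms isolates its bulk energy.\<close>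
    have "a + E * \<mu>\<^sub>2 - 2 * \<kappa>\<^sub>1 * P\<^sub>1 * (\<kappa>\<^sub>1 + \<mu>\<^sub>2) + 2 * \<mu>\<^sub>1 * S\<^sub>1 * (\<mu>\<^sub>1 - \<mu>\<^sub>2)
        = 2 * \<kappa>\<^sub>2 * P\<^sub>2 * (\<kappa>\<^sub>2 + \<mu>\<^sub>2)"
      unfolding E_eq a_eq by (simp add: power2_eq_square algebra_simps)
    then have E\<^sub>2b: "(a + E * \<mu>\<^sub>2 - 2 * \<kappa>\<^sub>1 * P\<^sub>1 * (\<kappa>\<^sub>1 + \<mu>\<^sub>2) + 2 * \<mu>\<^sub>1 * S\<^sub>1 * (\<mu>\<^sub>1 - \<mu>\<^sub>2)) / (\<kappa>\<^sub>2 + \<mu>\<^sub>2)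
        = 2 * \<kappa>\<^sub>2 * P\<^sub>2"
      using moduli_pos by simp
    \<comment> \<open>Dually, the bulk energy of phase 2 cancels in
      \<open>E * \<kappa>\<^sub>2 - a\<close>.\<close>
    have "(\<kappa>\<^sub>1 - \<kappa>\<^sub>2) * (2 * \<kappa>\<^sub>1 * P\<^sub>1) - (\<mu>\<^sub>1 + \<kappa>\<^sub>2) * (2 * \<mu>\<^sub>1 * S\<^sub>1) - a + E * \<kappa>\<^sub>2
        = 2 * \<mu>\<^sub>2 * S\<^sub>2 * (\<kappa>\<^sub>2 + \<mu>\<^sub>2)"
      unfolding E_eq a_eq by (simp add: power2_eq_square algebra_simps)
    then have E\<^sub>2s: "((\<kappa>\<^sub>1 - \<kappa>\<^sub>2) * (2 * \<kappa>\<^sub>1 * P\<^sub>1) - (\<mu>\<^sub>1 + \<kappa>\<^sub>2) * (2 * \<mu>\<^sub>1 * S\<^sub>1) - a + E * \<kappa>\<^sub>2) / (\<kappa>\<^sub>2 + \<mu>\<^sub>2)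
        = 2 * \<mu>\<^sub>2 * S\<^sub>2"
      using moduli_pos by simp
    \<comment> \<open>\<open>E * (\<mu>\<^sub>2 - \<kappa>\<^sub>2) + a\<close> already gives
      \<open>P\<^sub>2\<close> and \<open>S\<^sub>2\<close> the coefficients
      \<open>2 * \<kappa>\<^sub>2 * \<mu>\<^sub>2\<close> and its negative; the other two terms
      adjust \<open>P\<^sub>1\<close> and \<open>S\<^sub>1\<close> to match.\<close>
    have "E * (\<mu>\<^sub>2 - \<kappa>\<^sub>2) - 2 * \<kappa>\<^sub>1 * P\<^sub>1 / \<kappa>\<^sub>1 * (\<mu>\<^sub>2 + \<kappa>\<^sub>1) * (\<kappa>\<^sub>1 - \<kappa>\<^sub>2)
          + 2 * \<mu>\<^sub>1 * S\<^sub>1 / \<mu>\<^sub>1 * (\<mu>\<^sub>1 + \<kappa>\<^sub>2) * (\<mu>\<^sub>1 - \<mu>\<^sub>2) + a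
        = 2 * \<kappa>\<^sub>2 * \<mu>\<^sub>2 * (P\<^sub>1 + P\<^sub>2 - S\<^sub>1 - S\<^sub>2)"
      using moduli_pos unfolding E_eq a_eq by (simp add: power2_eq_square algebra_simps)
    also have "\<dots> \<le> 2 * \<kappa>\<^sub>2 * \<mu>\<^sub>2 * (2 * c)"
      using c_bound moduli_pos by (intro mult_left_mono) auto
    finally have fifth: "E * (\<mu>\<^sub>2 - \<kappa>\<^sub>2) - 2 * \<kappa>\<^sub>1 * P\<^sub>1 / \<kappa>\<^sub>1 * (\<mu>\<^sub>2 + \<kappa>\<^sub>1) * (\<kappa>\<^sub>1 - \<kappa>\<^sub>2)
          + 2 * \<mu>\<^sub>1 * S\<^sub>1 / \<mu>\<^sub>1 * (\<mu>\<^sub>1 + \<kappa>\<^sub>2) * (\<mu>\<^sub>1 - \<mu>\<^sub>2) + a \<le> 4 * \<kappa>\<^sub>2 * \<mu>\<^sub>2 * c"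
      by simp
    have "(2 * \<kappa>\<^sub>1 * P\<^sub>1, 2 * \<mu>\<^sub>1 * S\<^sub>1)
        \<in> feasible_region \<kappa>\<^sub>1 \<kappa>\<^sub>2 \<mu>\<^sub>1 \<mu>\<^sub>2 f\<^sub>1 f\<^sub>2 E a c A\<^sub>1b A\<^sub>2b A\<^sub>1s A\<^sub>2s"
      unfolding feasible_region_def mem_Collect_eq prod.case E\<^sub>2b E\<^sub>2s
      using bulk_bounds shear_bounds fifth by (intro conjI)
    with compatible show ?thesis
      by blast
  qed
  then show ?thesis
    by blast
qed

end
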